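(* Let $\mathcal G$ and $\mathcal H$ be nonzero real analytic functions of $(\rho,\theta)$ near $(0,0)$ whose common vertices satisfy the non-vanishing condition for addition, i.e. $\Lambda^V(\mathcal G\backslash\mathcal H)\cap\Lambda^V(\mathcal H\backslash\mathcal G)=\emptyset$. Then $\mathcal G+\mathcal H$ has the Newton polygon $$\mathcal N_{\mathcal G+\mathcal H}=\mathcal N\big(\Delta^V(\mathcal G)\cup\Delta^V(\mathcal H)\big),$$ the principal boundary of the lower convex semi-hull of $\Delta^V(\mathcal G)\cup\Delta^V(\mathcal H)$. Moreover, the edge-polynomials of $\mathcal G+\mathcal H$ satisfy $$(\mathcal G+\mathcal H)_{E_k(\mathcal G+\mathcal H)}=\mathcal G_{N_k}+\mathcal H_{N_k}\quad\text{for all }k=1,\dots,s(\mathcal G+\mathcal H),$$ where $N_k$ is the $k$-th edge (in order of increasing abscissa) of $\mathcal N(\Delta^V(\mathcal G)\cup\Delta^V(\mathcal H))$ and $s(\mathcal G+\mathcal H)$ is the number of edges of $\mathcal N_{\mathcal G+\mathcal H}$.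
   Context: For a real analytic $F(\rho,\theta)=\sum a_{i,j}(F)\rho^i\theta^j$ near $(0,0)$ let $\Delta(F)=\{(i,j)\in\mathbb Z_{\ge0}^2:a_{i,j}(F)\ne0\}$. For a set $Q$ of points of $\mathbb Z_{\ge0}^2$ in the $(u,v)$-plane its lower convex semi-hull is $\wp(Q)=\mathrm{conv}(Q+\mathbb R_{\ge0}^2)$. The boundary of $\wp(Q)$ (for $Q\neq\emptyset$) consists of a closed vertical ray, a closed horizontal ray and a compact polygon $\mathcal N(Q)$ (possibly a single point), called the principal boundary. The Newton polygon of $F\not\equiv0$ is $\mathcal N_F=\mathcal N(\Delta(F))$; $\Delta^V(F)$ is the set of its vertices, and $E_1(F),\dots,E_{s(F)}(F)$ are its edges in order of increasing abscissa. For a closed segment $\Gamma$ with end-points in $\mathbb Z_{\ge0}^2$, $F_\Gamma(\theta)=\sum_{(i,j)\in\Gamma\cap\Delta(F)}a_{i,j}(F)\theta^j$; when $\Gamma$ is an edge of $\mathcal N_F$ this is called an edge-polynomial. $\Lambda^V(\mathcal G\backslash\mathcal H)=\{(i,j)\in\Delta^V(\mathcal G)\cap\Delta(\mathcal H):a_{i,j}(\mathcal G)+a_{i,j}(\mathcal H)=0\}$, and $\Lambda^V(\mathcal H\backslash\mathcal G)=\{(i,j)\in\Delta^V(\mathcal H)\cap\Delta(\mathcal G):a_{i,j}(\mathcal G)+a_{i,j}(\mathcal H)=0\}$. *)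

theory Defs
  imports "HOL-Analysis.Analysis" "HOL-Computational_Algebra.Polynomial"
begin

section \<open>Real analytic functions of two variables near the origin\<close>

definition expansion_at_0 :: "(real \<times> real \<Rightarrow> real) \<Rightarrow> (nat \<times> nat \<Rightarrow> real) \<Rightarrow> bool" where
  "expansion_at_0 F a \<longleftrightarrow>
     (\<exists>r>0. \<forall>\<rho> \<theta>. \<bar>\<rho>\<bar> < r \<longrightarrow> \<bar>\<theta>\<bar> < r \<longrightarrow>
        ((\<lambda>(i, j). a (i, j) * \<rho> ^ i * \<theta> ^ j) has_sum F (\<rho>, \<theta>)) UNIV)"

definition real_analytic_at_0 :: "(real \<times> real \<Rightarrow> real) \<Rightarrow> bool" where
  "real_analytic_at_0 F \<longleftrightarrow> (\<exists>a. expansion_at_0 F a)"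

text \<open>Analytic functions are considered as germs: nonzero means not identically
  zero on any neighbourhood of the origin.\<close>

definition nonzero_at_0 :: "(real \<times> real \<Rightarrow> real) \<Rightarrow> bool" where
  "nonzero_at_0 F \<longleftrightarrow> \<not> (\<forall>\<^sub>F p in nhds (0, 0). F p = 0)"

text \<open>The coefficients \<open>a\<^sub>i\<^sub>j(F)\<close>; the expansion is unique, see \<open>expansion_at_0_unique\<close>.\<close>

definition coeff_at_0 :: "(real \<times> real \<Rightarrow> real) \<Rightarrow> nat \<times> nat \<Rightarrow> real" where
  "coeff_at_0 F = (THE a. expansion_at_0 F a)"

definition supp :: "(real \<times> real \<Rightarrow> real) \<Rightarrow> (nat \<times> nat) set" where
  "supp F = {p. coeff_at_0 F p \<noteq> 0}"

lemma powser_zero_coeffs: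
  fixes c :: "nat \<Rightarrow> real"
  assumes "r > 0" and s: "\<And>x. x \<noteq> 0 \<Longrightarrow> \<bar>x\<bar> < r \<Longrightarrow> (\<lambda>n. c n * x ^ n) sums 0"
  shows "c n = 0"
proof (induction n rule: less_induct)
  case (less n)
  have "(\<lambda>k. c (k + n) * x ^ k) sums 0" if x: "x \<noteq> 0" "\<bar>x\<bar> < r" for x
  proof -
    have "(\<Sum>i<n. c i * x ^ i) = 0" using less by simp
    then have "(\<lambda>k. c (k + n) * x ^ (k + n)) sums 0"
      using sums_split_initial_segment[OF s[OF x], of n] by simp
    then have "(\<lambda>k. c (k + n) * x ^ (k + n) / x ^ n) sums (0 / x ^ n)"
      by (rule sums_divide)
    then show ?thesis using x by (simp add: power_add)
  qed
  then have "((\<lambda>x::real. 0::real) \<longlongrightarrow> c (0 + n)) (at 0)"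
    using powser_limit_0_strong[of r "\<lambda>k. c (k + n)" "\<lambda>_. 0"] assms(1) by simp
  then have "c (0 + n) = 0"
    using tendsto_const_iff[of "at (0::real)" 0 "c (0 + n)"] by simp
  then show ?case by simp
qed

lemma expansion_at_0_unique:
  assumes "expansion_at_0 F a" "expansion_at_0 F b"
  shows "a = b"
proof -
  from assms obtain r1 r2 where r: "r1 > 0" "r2 > 0"
    and a: "\<And>x y. \<bar>x\<bar> < r1 \<Longrightarrow> \<bar>y\<bar> < r1 \<Longrightarrow>
       ((\<lambda>(i, j). a (i, j) * x ^ i * y ^ j) has_sum F (x, y)) UNIV"
    and b: "\<And>x y. \<bar>x\<bar> < r2 \<Longrightarrow> \<bar>y\<bar> < r2 \<Longrightarrow>
       ((\<lambda>(i, j). b (i, j) * x ^ i * y ^ j) has_sum F (x, y)) UNIV"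
    unfolding expansion_at_0_def by blast
  define r where "r = min r1 r2"
  define c where "c = (\<lambda>i j. a (i, j) - b (i, j))"
  have rpos: "r > 0" using r by (simp add: r_def)
  have c: "((\<lambda>(i, j). c i j * x ^ i * y ^ j) has_sum 0) (UNIV \<times> UNIV)"
    if "\<bar>x\<bar> < r" "\<bar>y\<bar> < r" for x y
  proof -
    have A: "((\<lambda>(i, j). a (i, j) * x ^ i * y ^ j) has_sum F (x, y)) UNIV"
      using a that r_def by simp
    have B: "((\<lambda>p. - (case p of (i, j) \<Rightarrow> b (i, j) * x ^ i * y ^ j)) has_sum - F (x, y)) UNIV"
      using b that r_def by (simp add: has_sum_uminus)
    show ?thesis
      using has_sum_add[OF A B] by (simp add: case_prod_unfold c_def algebra_simps)
  qed
  have row: "(\<Sum>\<^sub>\<infinity>j. c i j * y ^ j) = 0 \<and> (\<lambda>j. c i j * y ^ j) summable_on UNIV"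
    if y: "\<bar>y\<bar> < r" for y i
  proof -
    define g where "g i = (\<Sum>\<^sub>\<infinity>j. c i j * y ^ j)" for i
    have sm: "(\<lambda>j. c i j * y ^ j) summable_on UNIV" for i
    proof -
      have "(\<lambda>(i, j). c i j * (r / 2) ^ i * y ^ j) summable_on UNIV \<times> UNIV"
        using c[of "r / 2" y] y rpos summable_on_def by force
      then have "(\<lambda>j. c i j * (r / 2) ^ i * y ^ j) summable_on UNIV"
        by (rule summable_on_SigmaD1) simp
      then have "(\<lambda>j. inverse ((r / 2) ^ i) * (c i j * (r / 2) ^ i * y ^ j)) summable_on UNIV"
        by (rule summable_on_cmult_right)
      then show ?thesis using rpos by (simp add: field_simps)
    qed
    have "(\<lambda>i. g i * x ^ i) sums 0" if x: "\<bar>x\<bar> < r" for x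
    proof (rule has_sum_imp_sums, rule has_sum_SigmaD[OF c[OF x y]])
      fix i
      have "((\<lambda>j. x ^ i * (c i j * y ^ j)) has_sum x ^ i * g i) UNIV"
        unfolding g_def by (intro has_sum_cmult_right has_sum_infsum sm)
      then show "((\<lambda>j. case (i, j) of (i, j) \<Rightarrow> c i j * x ^ i * y ^ j) has_sum g i * x ^ i) UNIV"
        by (simp add: mult_ac)
    qed
    then have "g i = 0" using powser_zero_coeffs[OF rpos, of g] by blast
    then show ?thesis using sm by (simp add: g_def)
  qed
  have "c i j = 0" for i j
  proof (rule powser_zero_coeffs[OF rpos])
    fix y :: real assume "\<bar>y\<bar> < r"
    then show "(\<lambda>j. c i j * y ^ j) sums 0"
      using row[of y i] has_sum_infsum has_sum_imp_sums by metis
  qed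
  then show ?thesis by (auto simp: c_def)
qed

lemma coeff_at_0_eq: "expansion_at_0 F a \<Longrightarrow> coeff_at_0 F = a"
  unfolding coeff_at_0_def using expansion_at_0_unique by blast

section \<open>Newton polygons\<close>

definition semi_hull :: "(nat \<times> nat) set \<Rightarrow> (real \<times> real) set" where
  "semi_hull Q =
     convex hull {(real i + s, real j + t) | i j s t. (i, j) \<in> Q \<and> 0 \<le> s \<and> 0 \<le> t}"

text \<open>For nonempty \<open>Q\<close> the boundary of the semi-hull consists of the closed rays
  \<open>{a} \<times> {b..}\<close> and \<open>{c..} \<times> {d}\<close> and of the principal boundary, which meets each ray
  exactly in the end-point of that ray. Hence only the rays without their end-points are removed.\<close>

definition principal_boundary :: "(nat \<times> nat) set \<Rightarrow> (real \<times> real) set" where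
  "principal_boundary Q =
     (let P = semi_hull Q;
          a = Inf (fst ` P); b = Inf {v. (a, v) \<in> P};
          d = Inf (snd ` P); c = Inf {u. (u, d) \<in> P}
      in frontier P - ({a} \<times> {b<..} \<union> {c<..} \<times> {d}))"

text \<open>The vertices of the principal boundary are lattice points (elements of \<open>Q\<close>), so
  they are taken in \<open>nat \<times> nat\<close>.\<close>

definition polygon_vertices :: "(nat \<times> nat) set \<Rightarrow> (nat \<times> nat) set" where
  "polygon_vertices Q =
     {(i, j). (real i, real j) \<in> principal_boundary Q \<and>
              (real i, real j) extreme_point_of semi_hull Q}"

definition polygon_edges :: "(nat \<times> nat) set \<Rightarrow> (real \<times> real) set set" where
  "polygon_edges Q = {e. e edge_of semi_hull Q \<and> e \<subseteq> principal_boundary Q}"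

text \<open>The list of edges in order of increasing abscissa (of their left end-points).\<close>

definition edge_list :: "(nat \<times> nat) set \<Rightarrow> (real \<times> real) set list" where
  "edge_list Q =
     (THE es. set es = polygon_edges Q \<and>
              sorted_wrt (\<lambda>e e'. Inf (fst ` e) < Inf (fst ` e')) es)"

definition polygon_edge :: "(nat \<times> nat) set \<Rightarrow> nat \<Rightarrow> (real \<times> real) set" where
  "polygon_edge Q k = edge_list Q ! (k - 1)"

definition newton_polygon :: "(real \<times> real \<Rightarrow> real) \<Rightarrow> (real \<times> real) set" where
  "newton_polygon F = principal_boundary (supp F)"

definition newton_vertices :: "(real \<times> real \<Rightarrow> real) \<Rightarrow> (nat \<times> nat) set" where
  "newton_vertices F = polygon_vertices (supp F)"

definition newton_edge :: "(real \<times> real \<Rightarrow> real) \<Rightarrow> nat \<Rightarrow> (real \<times> real) set" where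
  "newton_edge F k = polygon_edge (supp F) k"

definition num_newton_edges :: "(real \<times> real \<Rightarrow> real) \<Rightarrow> nat" where
  "num_newton_edges F = card (polygon_edges (supp F))"

text \<open>The polynomial of \<open>F\<close> along \<open>\<Gamma>\<close>, meaningful for bounded \<open>\<Gamma>\<close> (where the sum is finite).\<close>

definition segment_poly :: "(real \<times> real \<Rightarrow> real) \<Rightarrow> (real \<times> real) set \<Rightarrow> real poly" where
  "segment_poly F \<Gamma> =
     (\<Sum>(i, j) \<in> {(i, j) \<in> supp F. (real i, real j) \<in> \<Gamma>}. monom (coeff_at_0 F (i, j)) j)"

definition cancelled_vertices ::
    "(real \<times> real \<Rightarrow> real) \<Rightarrow> (real \<times> real \<Rightarrow> real) \<Rightarrow> (nat \<times> nat) set" where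
  "cancelled_vertices G H =
     {p \<in> newton_vertices G \<inter> supp H. coeff_at_0 G p + coeff_at_0 H p = 0}"

end

theory Submission
  imports Defs
begin

text \<open>The principal boundary and the list of edges are computed from the semi-hull alone, so the
  theorem reduces to the equality of the semi-hulls of the support of \<open>G + H\<close> and of the union
  \<open>V\<close> of the two vertex sets (\<open>semi_hull_supp_sum\<close>).

  The main tool is that a semi-hull is generated by its vertices (\<open>semi_hull_polygon_vertices\<close>).
  It makes \<open>semi_hull V\<close> contain the supports of \<open>G\<close> and of \<open>H\<close>, hence that of \<open>G + H\<close>.
  Conversely, a vertex \<open>p\<close> of \<open>semi_hull V\<close> is a point of \<open>supp G\<close> or of \<open>supp H\<close>. If it lies in
  only one of them, its coefficient in \<open>G + H\<close> is nonzero. If it lies in both, it is an extreme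
  point of \<open>semi_hull V\<close> that belongs to both smaller semi-hulls, so it is a vertex of \<open>G\<close> and
  of \<open>H\<close>, and cancellation there is exactly what the non-vanishing condition excludes. So all
  vertices of \<open>semi_hull V\<close>, and with them the whole semi-hull, come from \<open>supp (G + H)\<close>.

  The identity of the edge-polynomials is then additivity of coefficients, provided that each
  edge contains only finitely many lattice points. This needs two facts about principal
  boundaries: they are bounded (\<open>principal_boundary_bounded\<close>), and distinct edges have distinct
  left abscissae (\<open>inj_on_Inf_fst_polygon_edges\<close>). The latter makes the ordered list of edges
  well-defined, so that its entries are indeed edges.\<close>

section \<open>Upward closed convex sets and semi-hulls\<close>

definition up_closed :: "'a::order set \<Rightarrow> bool" where
  "up_closed K \<longleftrightarrow> (\<forall>x\<in>K. \<forall>y. x \<le> y \<longrightarrow> y \<in> K)"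

lemma up_closedD: "up_closed K \<Longrightarrow> x \<in> K \<Longrightarrow> x \<le> y \<Longrightarrow> y \<in> K"
  unfolding up_closed_def by blast

lemma convex_semi_hull: "convex (semi_hull Q)"
  unfolding semi_hull_def by (rule convex_convex_hull)

lemma semi_hull_generator: "(i, j) \<in> Q \<Longrightarrow> (real i, real j) \<in> semi_hull Q"
  unfolding semi_hull_def by (rule hull_inc) force

text \<open>Translation by a nonnegative vector maps the generating set of the convex hull into itself,
  and convex hulls commute with translations.\<close>

lemma up_closed_semi_hull: "up_closed (semi_hull Q)"
  unfolding up_closed_def
proof (intro ballI allI impI)
  fix x y :: "real \<times> real"
  assume x: "x \<in> semi_hull Q" and "x \<le> y"
  let ?C = "{(real i + s, real j + t) | i j s t. (i, j) \<in> Q \<and> 0 \<le> s \<and> 0 \<le> t}"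
  define c where "c = y - x"
  have c: "0 \<le> fst c" "0 \<le> snd c"
    using \<open>x \<le> y\<close> by (auto simp: c_def less_eq_prod_def)
  have "(+) c ` ?C \<subseteq> ?C"
  proof (rule image_subsetI)
    fix p assume "p \<in> ?C"
    then obtain i j s t where p: "p = (real i + s, real j + t)" "(i, j) \<in> Q" "0 \<le> s" "0 \<le> t"
      by auto
    then have "c + p = (real i + (s + fst c), real j + (t + snd c))" by (simp add: prod_eq_iff)
    then show "c + p \<in> ?C" using p c by fastforce
  qed
  then have "(+) c ` semi_hull Q \<subseteq> semi_hull Q"
    unfolding semi_hull_def convex_hull_translation[symmetric] by (rule hull_mono)
  moreover have "y = c + x" by (simp add: c_def)
  ultimately show "y \<in> semi_hull Q" using x by blast
qed

lemma semi_hull_up: "(x, y) \<in> semi_hull Q \<Longrightarrow> x \<le> x' \<Longrightarrow> y \<le> y' \<Longrightarrow> (x', y') \<in> semi_hull Q"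
  using up_closedD[OF up_closed_semi_hull] by (metis Pair_le)

text \<open>Together with the preceding closure properties this characterises the semi-hull as the least
  upward closed convex set containing the given points; inclusions of semi-hulls are always
  reduced to it below.\<close>

lemma semi_hull_least:
  assumes "convex K" "up_closed K" "\<And>i j. (i, j) \<in> Q \<Longrightarrow> (real i, real j) \<in> K"
  shows "semi_hull Q \<subseteq> K"
  unfolding semi_hull_def
proof (rule hull_minimal)
  show "{(real i + s, real j + t) |i j s t. (i, j) \<in> Q \<and> 0 \<le> s \<and> 0 \<le> t} \<subseteq> K"
    using assms(3) by (force intro: up_closedD[OF assms(2)])
qed (rule assms(1))

lemma semi_hull_subset:
  assumes "\<And>i j. (i, j) \<in> Q \<Longrightarrow> (real i, real j) \<in> semi_hull R"
  shows "semi_hull Q \<subseteq> semi_hull R"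
  by (intro semi_hull_least convex_semi_hull up_closed_semi_hull assms)

lemma semi_hull_mono: "Q \<subseteq> R \<Longrightarrow> semi_hull Q \<subseteq> semi_hull R"
  by (rule semi_hull_subset) (auto intro: semi_hull_generator)

lemma semi_hull_eq_empty_iff: "semi_hull Q = {} \<longleftrightarrow> Q = {}"
proof
  show "semi_hull Q = {} \<Longrightarrow> Q = {}" using semi_hull_generator by fast
qed (simp add: semi_hull_def)

lemma semi_hull_fst_ge:
  assumes "\<And>i j. (i, j) \<in> Q \<Longrightarrow> l \<le> real i" "p \<in> semi_hull Q"
  shows "l \<le> fst p"
proof -
  have "semi_hull Q \<subseteq> fst -` {l..}"
  proof (rule semi_hull_least)
    show "convex (fst -` {l..})" by (intro convex_linear_vimage linear_fst) simp
    show "up_closed (fst -` {l..})"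
      unfolding up_closed_def using fst_mono order_trans by fastforce
  qed (use assms(1) in simp)
  then show ?thesis using assms(2) by auto
qed

lemma semi_hull_snd_ge:
  assumes "\<And>i j. (i, j) \<in> Q \<Longrightarrow> l \<le> real j" "p \<in> semi_hull Q"
  shows "l \<le> snd p"
proof -
  have "semi_hull Q \<subseteq> snd -` {l..}"
  proof (rule semi_hull_least)
    show "convex (snd -` {l..})" by (intro convex_linear_vimage linear_snd) simp
    show "up_closed (snd -` {l..})"
      unfolding up_closed_def using snd_mono order_trans by fastforce
  qed (use assms(1) in simp)
  then show ?thesis using assms(2) by auto
qed

section \<open>Vertices\<close>

lemma extreme_point_of_midpoint:
  fixes p q :: "'a::euclidean_space"
  assumes "midpoint p q extreme_point_of K" "p \<in> K" "q \<in> K"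
  shows "p = q"
  using assms midpoint_in_open_segment[of p q] unfolding extreme_point_of_def by blast

text \<open>An extreme point of a convex hull is one of the generators \<open>(i + s, j + t)\<close>. Such a
  generator is the midpoint of \<open>(i, j)\<close> and \<open>(i + 2s, j + 2t)\<close>, so \<open>s = t = 0\<close>.\<close>

lemma extreme_point_semi_hull_in_generators:
  assumes "(real i, real j) extreme_point_of semi_hull Q"
  shows "(i, j) \<in> Q"
proof -
  let ?p = "(real i, real j)"
  obtain i' j' s t where *: "?p = (real i' + s, real j' + t)" "(i', j') \<in> Q" "0 \<le> s" "0 \<le> t"
    using extreme_point_of_convex_hull[OF assms[unfolded semi_hull_def]] by auto
  have "(real i', real j') \<in> semi_hull Q"
    using * by (intro semi_hull_generator)
  moreover from this have "(real i' + 2 * s, real j' + 2 * t) \<in> semi_hull Q"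
    by (rule semi_hull_up) (use * in auto)
  moreover have "?p = midpoint (real i', real j') (real i' + 2 * s, real j' + 2 * t)"
    using * by (simp add: midpoint_def)
  ultimately have "(real i', real j') = (real i' + 2 * s, real j' + 2 * t)"
    using assms extreme_point_of_midpoint by metis
  then show ?thesis using * by simp
qed

text \<open>Past its end-point, a boundary ray consists of midpoints of a lower point of the ray and a
  higher one, so extreme points avoid the part of the frontier that is removed. Hence the
  vertices of the polygon are just the extreme lattice points of the semi-hull.\<close>

lemma extreme_point_in_principal_boundary:
  assumes "(x, y) extreme_point_of semi_hull Q"
  shows "(x, y) \<in> principal_boundary Q"
proof -
  let ?P = "semi_hull Q"
  have P: "(x, y) \<in> ?P" using assms by (simp add: extreme_point_of_def)
  have "(x, y) \<in> frontier ?P"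
    using P extreme_point_not_in_interior[OF assms] closure_subset
    unfolding frontier_def by auto
  moreover have "\<not> Inf {v. (x, v) \<in> ?P} < y"
  proof
    assume "Inf {v. (x, v) \<in> ?P} < y"
    then obtain v where v: "(x, v) \<in> ?P" "v < y"
      using cInf_lessD[of "{v. (x, v) \<in> ?P}" y] P by auto
    have "midpoint (x, v) (x, y + (y - v)) = (x, y)" by (simp add: midpoint_def)
    moreover have "(x, y + (y - v)) \<in> ?P" by (rule semi_hull_up[OF P]) (use v in auto)
    ultimately have "(x, v) = (x, y + (y - v))"
      using v(1) assms by (intro extreme_point_of_midpoint[of _ _ ?P]) auto
    then show False using v(2) by simp
  qed
  moreover have "\<not> Inf {u. (u, y) \<in> ?P} < x"
  proof
    assume "Inf {u. (u, y) \<in> ?P} < x"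
    then obtain u where u: "(u, y) \<in> ?P" "u < x"
      using cInf_lessD[of "{u. (u, y) \<in> ?P}" x] P by auto
    have "midpoint (u, y) (x + (x - u), y) = (x, y)" by (simp add: midpoint_def)
    moreover have "(x + (x - u), y) \<in> ?P" by (rule semi_hull_up[OF P]) (use u in auto)
    ultimately have "(u, y) = (x + (x - u), y)"
      using u(1) assms by (intro extreme_point_of_midpoint[of _ _ ?P]) auto
    then show False using u(2) by simp
  qed
  ultimately show ?thesis
    unfolding principal_boundary_def Let_def by auto
qed

lemma polygon_vertices_iff_extreme:
  "(i, j) \<in> polygon_vertices Q \<longleftrightarrow> (real i, real j) extreme_point_of semi_hull Q"
  unfolding polygon_vertices_def using extreme_point_in_principal_boundary by auto

lemma polygon_vertices_subset: "polygon_vertices Q \<subseteq> Q"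
  using extreme_point_semi_hull_in_generators polygon_vertices_iff_extreme by auto

text \<open>Dickson's lemma in dimension two: relative to a fixed point \<open>(i0, j0)\<close> of \<open>Q\<close>, any other point
  lies in one of the columns up to \<open>i0\<close>, in one of the rows up to \<open>j0\<close>, or above \<open>(i0, j0)\<close>, and
  in each of the finitely many columns and rows the lowest point suffices.\<close>

lemma finite_dominating_subset:
  fixes Q :: "(nat \<times> nat) set"
  obtains M where "finite M" "M \<subseteq> Q" "\<And>q. q \<in> Q \<Longrightarrow> \<exists>m\<in>M. m \<le> q"
proof (cases "Q = {}")
  case False
  then obtain i0 j0 where q0: "(i0, j0) \<in> Q" by auto
  define f where "f i = (LEAST j. (i, j) \<in> Q)" for i
  define g where "g j = (LEAST i. (i, j) \<in> Q)" for j
  define M where "M = Q \<inter> insert (i0, j0) ((\<lambda>i. (i, f i)) ` {..i0} \<union> (\<lambda>j. (g j, j)) ` {..j0})"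
  show ?thesis
  proof
    show "finite M" "M \<subseteq> Q" unfolding M_def by auto
    fix q assume "q \<in> Q"
    then obtain i j where q: "q = (i, j)" "(i, j) \<in> Q" by (cases q) auto
    have f: "(i, f i) \<in> Q" "f i \<le> j"
      using q LeastI[of "\<lambda>j. (i, j) \<in> Q" j] Least_le[of "\<lambda>j. (i, j) \<in> Q" j] by (auto simp: f_def)
    have g: "(g j, j) \<in> Q" "g j \<le> i"
      using q LeastI[of "\<lambda>i. (i, j) \<in> Q" i] Least_le[of "\<lambda>i. (i, j) \<in> Q" i] by (auto simp: g_def)
    consider "i \<le> i0" | "j \<le> j0" | "i0 \<le> i" "j0 \<le> j" by linarith
    then show "\<exists>m\<in>M. m \<le> q"
    proof cases
      case 1
      with f q show ?thesis by (intro bexI[of _ "(i, f i)"]) (auto simp: M_def)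
    next
      case 2
      with g q show ?thesis by (intro bexI[of _ "(g j, j)"]) (auto simp: M_def)
    next
      case 3
      with q q0 show ?thesis by (intro bexI[of _ "(i0, j0)"]) (auto simp: M_def)
    qed
  qed
qed (use that[of "{}"] in auto)

text \<open>The semi-hull of \<open>E\<close> is contained in the translate to \<open>v = (a, b)\<close> of the convex cone \<open>K\<close>
  spanned by the quadrant and the directions from \<open>v\<close> to the semi-hull of the other generators.
  If \<open>K\<close> contained a line, averaging would place \<open>v\<close> itself in that semi-hull. So \<open>K\<close> is pointed,
  which makes its apex an extreme point.\<close>

lemma extreme_point_of_irredundant_generator:
  assumes v: "(a, b) \<in> E" and irr: "(real a, real b) \<notin> semi_hull (E - {(a, b)})"
  shows "(real a, real b) extreme_point_of semi_hull E"
proof -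
  let ?v = "(real a, real b)" and ?P' = "semi_hull (E - {(a, b)})"
  define T where "T = {d. \<exists>t>0. ?v + t *\<^sub>R d \<in> ?P'}"
  define K where "K = T \<union> {0..}"
  \<comment> \<open>\<open>T\<close> absorbs all of \<open>K\<close> under addition and lacks 0, since \<open>v\<close> is irredundant. So opposite
    vectors of \<open>K\<close> must both lie in the quadrant.\<close>
  have T_up: "d + c \<in> T" if d: "d \<in> T" and c: "0 \<le> c" for c d
  proof -
    obtain t where t: "t > 0" "?v + t *\<^sub>R d \<in> ?P'" using d by (auto simp: T_def)
    have "?v + t *\<^sub>R d \<le> ?v + t *\<^sub>R (d + c)"
      using t(1) c by (intro add_left_mono scaleR_left_mono) auto
    then show ?thesis
      using t up_closedD[OF up_closed_semi_hull] unfolding T_def by blast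
  qed
  have T_add: "d + d' \<in> T" if d: "d \<in> T" and d': "d' \<in> T" for d d'
  proof -
    obtain t where t: "t > 0" "?v + t *\<^sub>R d \<in> ?P'" using d by (auto simp: T_def)
    obtain t' where t': "t' > 0" "?v + t' *\<^sub>R d' \<in> ?P'" using d' by (auto simp: T_def)
    \<comment> \<open>The weights are chosen so that \<open>d\<close> and \<open>d'\<close> receive the same factor \<open>t * t' / (t + t')\<close>.\<close>
    have sum1: "t' / (t + t') + t / (t + t') = 1"
      using t t' by (simp add: add_divide_distrib[symmetric])
    have "(t' / (t + t')) *\<^sub>R (?v + t *\<^sub>R d) + (t / (t + t')) *\<^sub>R (?v + t' *\<^sub>R d') \<in> ?P'"
      using t t' sum1 by (intro convexD[OF convex_semi_hull]) auto
    also have "(t' / (t + t')) *\<^sub>R (?v + t *\<^sub>R d) + (t / (t + t')) *\<^sub>R (?v + t' *\<^sub>R d')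
       = (t' / (t + t') + t / (t + t')) *\<^sub>R ?v + (t * t' / (t + t')) *\<^sub>R (d + d')"
      by (simp add: algebra_simps)
    finally have "?v + (t * t' / (t + t')) *\<^sub>R (d + d') \<in> ?P'"
      by (simp only: sum1 scaleR_one)
    moreover have "t * t' / (t + t') > 0" using t t' by simp
    ultimately show ?thesis unfolding T_def by blast
  qed
  have T_scale: "s *\<^sub>R d \<in> T" if d: "d \<in> T" and s: "s > 0" for s d
  proof -
    obtain t where t: "t > 0" "?v + t *\<^sub>R d \<in> ?P'" using d by (auto simp: T_def)
    have "t / s > 0" "?v + (t / s) *\<^sub>R (s *\<^sub>R d) \<in> ?P'" using t s by auto
    then show ?thesis unfolding T_def by blast
  qed
  have K_add: "d + d' \<in> K" if "d \<in> K" "d' \<in> K" for d d'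
    using that T_add[of d d'] T_up[of d d'] T_up[of d' d] by (auto simp: K_def add.commute)
  have K_scale: "s *\<^sub>R d \<in> K" if "d \<in> K" "s \<ge> 0" for s d
    using that T_scale[of d s] by (cases "s = 0") (auto simp: K_def scaleR_nonneg_nonneg)
  have K: "semi_hull E \<subseteq> {x. x - ?v \<in> K}"
  proof (rule semi_hull_least)
    show "convex {x. x - ?v \<in> K}"
    proof (rule convexI, clarify)
      fix x y and s t :: real
      assume "x - ?v \<in> K" "y - ?v \<in> K" "0 \<le> s" "0 \<le> t" "s + t = 1"
      then have "s *\<^sub>R (x - ?v) + t *\<^sub>R (y - ?v) \<in> K" using K_add K_scale by blast
      also have "s *\<^sub>R (x - ?v) + t *\<^sub>R (y - ?v) = s *\<^sub>R x + t *\<^sub>R y - (s + t) *\<^sub>R ?v"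
        by (simp add: scaleR_diff_right scaleR_add_left del: scaleR_Pair)
      finally show "s *\<^sub>R x + t *\<^sub>R y - ?v \<in> K"
        using \<open>s + t = 1\<close> by (simp only: scaleR_one)
    qed
    show "up_closed {x. x - ?v \<in> K}"
      unfolding up_closed_def
    proof clarify
      fix x y assume "x - ?v \<in> K" "x \<le> y"
      then have "(x - ?v) + (y - x) \<in> K" by (intro K_add) (auto simp: K_def)
      moreover have "(x - ?v) + (y - x) = y - ?v" by (simp add: prod_eq_iff)
      ultimately show "y - ?v \<in> K" by simp
    qed
    fix i j assume ij: "(i, j) \<in> E"
    show "(real i, real j) \<in> {x. x - ?v \<in> K}"
    proof (cases "(i, j) = (a, b)")
      case True
      then show ?thesis by (simp add: K_def zero_prod_def)
    next
      case False
      then have "?v + 1 *\<^sub>R ((real i, real j) - ?v) \<in> ?P'"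
        using ij by (simp add: semi_hull_generator)
      then have "(real i, real j) - ?v \<in> T" unfolding T_def using zero_less_one by blast
      then show ?thesis by (simp add: K_def)
    qed
  qed
  have T0: "0 \<notin> T" using irr by (simp add: T_def zero_prod_def)
  have pointed: "d = 0" if "d \<in> K" "- d \<in> K" for d
    using that T_add[of d "- d"] T_up[of d "- d"] T_up[of "- d" d] T0
    by (auto simp: K_def)
  show ?thesis
    unfolding extreme_point_of_def
  proof (intro conjI ballI notI)
    show "?v \<in> semi_hull E" using v by (rule semi_hull_generator)
    fix x y assume x: "x \<in> semi_hull E" and y: "y \<in> semi_hull E" and seg: "?v \<in> open_segment x y"
    obtain u where u: "0 < u" "u < 1" "?v = (1 - u) *\<^sub>R x + u *\<^sub>R y" and "x \<noteq> y"
      using seg by (auto simp: in_segment)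
    have "u *\<^sub>R (y - ?v) + (1 - u) *\<^sub>R (x - ?v) = 0"
      by (subst (1 2) u(3)) (simp add: algebra_simps)
    then have eq: "u *\<^sub>R (y - ?v) = - ((1 - u) *\<^sub>R (x - ?v))"
      by (simp add: add_eq_0_iff2)
    have "(1 - u) *\<^sub>R (x - ?v) = 0"
    proof (rule pointed)
      show "(1 - u) *\<^sub>R (x - ?v) \<in> K" using K x u(2) by (intro K_scale) auto
      show "- ((1 - u) *\<^sub>R (x - ?v)) \<in> K"
        unfolding eq[symmetric] using K y u(1) by (intro K_scale) auto
    qed
    then have "x = ?v" using u by simp
    then show False using seg by (simp add: open_segment_def)
  qed
qed

text \<open>By \<open>finite_dominating_subset\<close> some finite set generates the semi-hull, and in a
  generating set of least cardinality every point is irredundant, hence a vertex.\<close>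

lemma semi_hull_polygon_vertices: "semi_hull (polygon_vertices Q) = semi_hull Q"
proof
  show "semi_hull (polygon_vertices Q) \<subseteq> semi_hull Q"
    by (rule semi_hull_mono[OF polygon_vertices_subset])
  obtain M where M: "finite M" "M \<subseteq> Q" "\<And>q. q \<in> Q \<Longrightarrow> \<exists>m\<in>M. m \<le> q"
    using finite_dominating_subset[of Q] by auto
  define good where "good E \<longleftrightarrow> finite E \<and> semi_hull E = semi_hull Q" for E
  have "semi_hull Q \<subseteq> semi_hull M"
  proof (rule semi_hull_subset)
    fix i j assume "(i, j) \<in> Q"
    then obtain i' j' where "(i', j') \<in> M" "i' \<le> i" "j' \<le> j" using M(3) by fastforce
    then show "(real i, real j) \<in> semi_hull M"
      using semi_hull_up[OF semi_hull_generator] by simp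
  qed
  then have "good M" using M(1) semi_hull_mono[OF M(2)] by (auto simp: good_def)
  then obtain E where E: "good E" and min: "\<And>E'. good E' \<Longrightarrow> card E \<le> card E'"
    using ex_has_least_nat[of good M card] by auto
  have "E \<subseteq> polygon_vertices Q"
  proof clarify
    fix a b assume ab: "(a, b) \<in> E"
    have "\<not> good (E - {(a, b)})"
      using min[of "E - {(a, b)}"] ab E card_Diff1_less[of E "(a, b)"] by (auto simp: good_def)
    then have "\<not> semi_hull E \<subseteq> semi_hull (E - {(a, b)})"
      using E semi_hull_mono[of "E - {(a, b)}" E] by (auto simp: good_def)
    then have "(real a, real b) \<notin> semi_hull (E - {(a, b)})"
      using semi_hull_subset[of E "E - {(a, b)}"] semi_hull_generator[of _ _ "E - {(a, b)}"] by blast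
    then have "(real a, real b) extreme_point_of semi_hull E"
      using ab by (intro extreme_point_of_irredundant_generator)
    then show "(a, b) \<in> polygon_vertices Q"
      using E by (simp add: polygon_vertices_iff_extreme good_def)
  qed
  then show "semi_hull Q \<subseteq> semi_hull (polygon_vertices Q)"
    using E semi_hull_mono unfolding good_def by blast
qed

section \<open>Edges\<close>

text \<open>The least abscissa and the least ordinate are attained. So a frontier point to the right of
  the end-point of the horizontal ray must lie on that ray: otherwise it would be strictly above
  and to the right of some point of the semi-hull and so be interior. Likewise for points above
  the end-point of the vertical ray.\<close>

lemma principal_boundary_bounded:
  assumes "Q \<noteq> {}"
  obtains b c where "principal_boundary Q \<subseteq> {0..c} \<times> {0..b}"
proof -
  let ?P = "semi_hull Q"
  obtain i0 where i0: "i0 \<in> fst ` Q" "\<And>i. i \<in> fst ` Q \<Longrightarrow> i0 \<le> i"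
    using assms LeastI_ex[of "\<lambda>n. n \<in> fst ` Q"] Least_le[of "\<lambda>n. n \<in> fst ` Q"] by blast
  obtain j1 where j1: "j1 \<in> snd ` Q" "\<And>j. j \<in> snd ` Q \<Longrightarrow> j1 \<le> j"
    using assms LeastI_ex[of "\<lambda>n. n \<in> snd ` Q"] Least_le[of "\<lambda>n. n \<in> snd ` Q"] by blast
  obtain j0 where j0: "(i0, j0) \<in> Q" using i0 by auto
  obtain i1 where i1: "(i1, j1) \<in> Q" using j1 by auto
  have ge: "real i0 \<le> fst p" "real j1 \<le> snd p" if "p \<in> ?P" for p
  proof -
    show "real i0 \<le> fst p"
      using semi_hull_fst_ge[OF _ that] i0(2) by (metis fst_conv image_eqI of_nat_le_iff)
    show "real j1 \<le> snd p"
      using semi_hull_snd_ge[OF _ that] j1(2) by (metis snd_conv image_eqI of_nat_le_iff)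
  qed
  have P0: "(real i0, real j0) \<in> ?P" and P1: "(real i1, real j1) \<in> ?P"
    using j0 i1 by (auto intro: semi_hull_generator)
  have a: "Inf (fst ` ?P) = real i0"
  proof (rule cInf_eq_minimum)
    show "real i0 \<in> fst ` ?P" using imageI[OF P0, of fst] by simp
  qed (use ge in blast)
  have d: "Inf (snd ` ?P) = real j1"
  proof (rule cInf_eq_minimum)
    show "real j1 \<in> snd ` ?P" using imageI[OF P1, of snd] by simp
  qed (use ge in blast)
  define b where "b = Inf {v. (real i0, v) \<in> ?P}"
  define c where "c = Inf {u. (u, real j1) \<in> ?P}"
  have pb: "principal_boundary Q = frontier ?P - ({real i0} \<times> {b<..} \<union> {c<..} \<times> {real j1})"
    unfolding principal_boundary_def Let_def a d b_def c_def ..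
  have interior: "(x, y) \<in> interior ?P" if "(u, v) \<in> ?P" "u < x" "v < y" for u v x y
  proof (rule interiorI)
    show "open ({u<..} \<times> {v<..})" by (intro open_Times) auto
    show "(x, y) \<in> {u<..} \<times> {v<..}" using that by auto
    show "{u<..} \<times> {v<..} \<subseteq> ?P" using semi_hull_up[OF that(1)] by auto
  qed
  have "principal_boundary Q \<subseteq> {0..c} \<times> {0..b}"
  proof clarify
    fix x y assume xy: "(x, y) \<in> principal_boundary Q"
    then have ni: "(x, y) \<notin> interior ?P" and cl: "(x, y) \<in> closure ?P"
      by (auto simp: pb frontier_def)
    have "closure ?P \<subseteq> {real i0..} \<times> {real j1..}"
      using ge by (intro closure_minimal closed_Times) (auto simp: mem_Times_iff)
    then have x: "real i0 \<le> x" and y: "real j1 \<le> y" using cl by auto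
    have "\<not> c < x"
    proof
      assume "c < x"
      then obtain u where "(u, real j1) \<in> ?P" "u < x"
        using cInf_lessD[of "{u. (u, real j1) \<in> ?P}" x] P1 by (auto simp: c_def)
      then have "\<not> real j1 < y" using ni interior by blast
      then show False using xy \<open>c < x\<close> y by (auto simp: pb)
    qed
    moreover have "\<not> b < y"
    proof
      assume "b < y"
      then obtain v where "(real i0, v) \<in> ?P" "v < y"
        using cInf_lessD[of "{v. (real i0, v) \<in> ?P}" y] P0 by (auto simp: b_def)
      then have "\<not> real i0 < x" using ni interior by blast
      then show False using xy \<open>b < y\<close> x by (auto simp: pb)
    qed
    ultimately show "x \<in> {0..c} \<and> y \<in> {0..b}" using x y by auto
  qed
  then show ?thesis by (rule that)
qed

lemma finite_lattice_points_principal_boundary: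
  assumes "Q \<noteq> {}" "e \<subseteq> principal_boundary Q"
  shows "finite {(i, j). (real i, real j) \<in> e}"
proof -
  obtain b c where bc: "principal_boundary Q \<subseteq> {0..c} \<times> {0..b}"
    using principal_boundary_bounded[OF assms(1)] by blast
  have "{(i, j). (real i, real j) \<in> e} \<subseteq> {..nat \<lfloor>c\<rfloor>} \<times> {..nat \<lfloor>b\<rfloor>}"
  proof clarsimp
    fix i j assume "(real i, real j) \<in> e"
    then have "real i \<le> c" "real j \<le> b" using assms(2) bc by fastforce+
    then show "i \<le> nat \<lfloor>c\<rfloor> \<and> j \<le> nat \<lfloor>b\<rfloor>" by (simp add: le_nat_floor)
  qed
  then show ?thesis by (rule finite_subset) auto
qed

text \<open>If a face contained a point lying above another point of the semi-hull on the same vertical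
  line, it would contain the whole upward ray from there, contrary to boundedness.\<close>

lemma principal_face_is_lowest:
  assumes "Q \<noteq> {}" "e face_of semi_hull Q" "e \<subseteq> principal_boundary Q"
    and e: "(x, y) \<in> e" and P: "(x, y') \<in> semi_hull Q"
  shows "y \<le> y'"
proof (rule ccontr)
  assume less: "\<not> y \<le> y'"
  obtain b c where bc: "principal_boundary Q \<subseteq> {0..c} \<times> {0..b}"
    using principal_boundary_bounded[OF assms(1)] by blast
  \<comment> \<open>A height above both the given point and the whole principal boundary.\<close>
  define h where "h = \<bar>b\<bar> + \<bar>y\<bar> + 1"
  have "(x, y) \<in> semi_hull Q" using e assms(2) face_of_imp_subset by blast
  then have top: "(x, h) \<in> semi_hull Q" by (rule semi_hull_up) (auto simp: h_def)
  have "(x, y) \<in> open_segment (x, y') (x, h)"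
    unfolding in_segment
  proof (intro conjI exI)
    have "y < h" by (simp add: h_def)
    with less show "(x, y') \<noteq> (x, h)" "0 < (y - y') / (h - y')" "(y - y') / (h - y') < 1"
      by (auto simp: field_simps)
    have "h - y' \<noteq> 0" using less \<open>y < h\<close> by simp
    then have "(1 - (y - y') / (h - y')) * y' + (y - y') / (h - y') * h = y"
      by (simp add: divide_simps) (simp add: algebra_simps)
    then show "(x, y) = (1 - (y - y') / (h - y')) *\<^sub>R (x, y') + ((y - y') / (h - y')) *\<^sub>R (x, h)"
      by (simp add: algebra_simps)
  qed
  then have "(x, h) \<in> e" using assms(2) P top e unfolding face_of_def by blast
  then have "h \<le> b" using assms(3) bc by fastforce
  then show False by (simp add: h_def)
qed

text \<open>By \<open>principal_face_is_lowest\<close> all edges lie on the graph of one function of the abscissa, and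
  an edge projects injectively onto an interval of positive length. Two edges whose
  projections have the same infimum overlap over a nontrivial interval, so their intersection
  is a face of dimension one and equals both of them.\<close>

lemma inj_on_Inf_fst_polygon_edges:
  assumes "Q \<noteq> {}"
  shows "inj_on (\<lambda>e. Inf (fst ` e)) (polygon_edges Q)"
proof (rule inj_onI)
  fix e e' assume ee: "e \<in> polygon_edges Q" "e' \<in> polygon_edges Q"
    and Inf_eq: "Inf (fst ` e) = Inf (fst ` e')"
  let ?P = "semi_hull Q"
  let ?m = "Inf (fst ` e)"
  \<comment> \<open>Used both with two different edges and, for injectivity of the projection, with \<open>d = d'\<close>.\<close>
  have graph: "y = y'" if "d \<in> polygon_edges Q" "d' \<in> polygon_edges Q" "(x, y) \<in> d" "(x, y') \<in> d'"
    for d d' x y y'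
  proof -
    have d: "d face_of ?P" "d \<subseteq> principal_boundary Q" "d' face_of ?P" "d' \<subseteq> principal_boundary Q"
      using that(1,2) by (auto simp: polygon_edges_def edge_of_def)
    then have "(x, y) \<in> ?P" "(x, y') \<in> ?P" using that(3,4) face_of_imp_subset by blast+
    then show ?thesis
      using principal_face_is_lowest[OF assms] d that(3,4) by (meson order_antisym)
  qed
  have right: "\<exists>w > Inf (fst ` d). {Inf (fst ` d)<..w} \<subseteq> fst ` d"
    if d: "d \<in> polygon_edges Q" for d
  proof -
    have dim: "aff_dim d = 1" and pb: "d \<subseteq> principal_boundary Q" and face: "d face_of ?P"
      using d by (auto simp: polygon_edges_def edge_of_def)
    have inj: "inj_on fst d" using graph[OF d d] by (auto simp: inj_on_def)
    have "\<not> d \<subseteq> {p}" for p using dim aff_dim_subset[of d "{p}"] by auto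
    then obtain p q where "p \<in> d" "q \<in> d" "p \<noteq> q" by blast
    then have "fst p \<noteq> fst q" using inj by (meson inj_onD)
    then obtain z w where zw: "z \<in> fst ` d" "w \<in> fst ` d" "z < w"
      using \<open>p \<in> d\<close> \<open>q \<in> d\<close> by (metis image_eqI linorder_neqE)
    obtain b c where "principal_boundary Q \<subseteq> {0..c} \<times> {0..b}"
      using principal_boundary_bounded[OF assms] by blast
    then have "\<forall>p\<in>d. 0 \<le> fst p" using pb by fastforce
    then have "bdd_below (fst ` d)" by (intro bdd_belowI2) auto
    then have Infz: "Inf (fst ` d) \<le> z" using zw(1) by (intro cInf_lower)
    have conv: "is_interval (fst ` d)"
      using face_of_imp_convex[OF face]
      by (simp add: is_interval_convex_1 convex_linear_image linear_fst)
    have "{Inf (fst ` d)<..w} \<subseteq> fst ` d"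
    proof
      fix x assume x: "x \<in> {Inf (fst ` d)<..w}"
      then obtain z' where "z' \<in> fst ` d" "z' < x"
        using cInf_lessD[of "fst ` d" x] zw(1) by auto
      then show "x \<in> fst ` d"
        using mem_is_interval_1_I[OF conv _ zw(2), of z' x] x by auto
    qed
    then show ?thesis using Infz zw(3) by (intro exI[of _ w]) auto
  qed
  obtain w where w: "w > ?m" "{?m<..w} \<subseteq> fst ` e" using right[OF ee(1)] by auto
  obtain w' where w': "w' > ?m" "{?m<..w'} \<subseteq> fst ` e'" using right[OF ee(2)] Inf_eq by auto
  have common: "\<exists>y. (x, y) \<in> e \<inter> e'" if "?m < x" "x \<le> min w w'" for x
  proof -
    have "x \<in> fst ` e" "x \<in> fst ` e'" using w w' that by auto
    then show ?thesis using graph[OF ee] by fastforce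
  qed
  define x1 where "x1 = min w w'"
  define x2 where "x2 = (?m + x1) / 2"
  have x: "?m < x1" "?m < x2" "x2 < x1" using w w' by (auto simp: x1_def x2_def)
  obtain y1 y2 where y: "(x1, y1) \<in> e \<inter> e'" "(x2, y2) \<in> e \<inter> e'"
    using common[of x1] common[of x2] x by (auto simp: x1_def)
  have faces: "e face_of ?P" "e' face_of ?P" and dims: "aff_dim e = 1" "aff_dim e' = 1"
    using ee by (auto simp: polygon_edges_def edge_of_def)
  have "aff_dim {(x1, y1), (x2, y2)} = 1" using x by (simp add: aff_dim_2)
  then have dim_ge: "aff_dim (e \<inter> e') \<ge> 1" using aff_dim_subset[of "{(x1, y1), (x2, y2)}" "e \<inter> e'"] y by simp
  have int: "(e \<inter> e') face_of ?P" using faces by (rule face_of_Int)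
  have "e \<inter> e' = d" if "d = e \<or> d = e'" for d
  proof (rule ccontr)
    assume "e \<inter> e' \<noteq> d"
    moreover have "(e \<inter> e') face_of d"
      using that faces by (intro face_of_subset[OF int]) (auto dest: face_of_imp_subset)
    moreover have "convex d" using that faces face_of_imp_convex by blast
    ultimately have "aff_dim (e \<inter> e') < aff_dim d" by (intro face_of_aff_dim_lt)
    then show False using dim_ge dims that by auto
  qed
  then show "e = e'" by blast
qed

text \<open>With the injectivity of the left abscissa this gives meaning to the definite description that
  defines the ordered list of edges.\<close>

lemma ex1_strictly_sorted_by_key:
  fixes key :: "'a \<Rightarrow> 'b::linorder"
  assumes "finite X" "inj_on key X"
  shows "\<exists>!xs. set xs = X \<and> sorted_wrt (\<lambda>x y. key x < key y) xs"
proof -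
  obtain ks where ks: "sorted_wrt (<) ks" "set ks = key ` X"
    using ex1_sorted_list_for_set_if_finite[of "key ` X"] assms(1) by auto
  define xs where "xs = map (inv_into X key) ks"
  have key_xs: "map key xs = ks"
    using ks(2) by (auto simp: xs_def f_inv_into_f intro!: map_idI)
  show ?thesis
  proof (rule ex1I[of _ xs], intro conjI)
    show "set xs = X" using ks(2) assms(2) by (simp add: xs_def inv_into_image_cancel)
    show "sorted_wrt (\<lambda>x y. key x < key y) xs"
      using ks(1) by (simp flip: key_xs add: sorted_wrt_map)
    fix ys assume ys: "set ys = X \<and> sorted_wrt (\<lambda>x y. key x < key y) ys"
    have "map key ys = map key xs"
      using ex1_sorted_list_for_set_if_finite[of "key ` X"] ks ys assms(1) key_xs
      by (metis finite_imageI list.set_map sorted_wrt_map)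
    then show "ys = xs"
      using ys \<open>set xs = X\<close> assms(2) by (simp add: inj_on_map_eq_map)
  qed
qed

text \<open>An infinite set of edges would have cardinality 0, so the existence of an admissible index
  already makes the set of edges finite.\<close>

lemma polygon_edge_in_polygon_edges:
  assumes "Q \<noteq> {}" "k \<in> {1..card (polygon_edges Q)}"
  shows "polygon_edge Q k \<in> polygon_edges Q"
proof -
  have "finite (polygon_edges Q)" using assms(2) card.infinite by fastforce
  from theI'[OF ex1_strictly_sorted_by_key[OF this inj_on_Inf_fst_polygon_edges[OF assms(1)]]]
  have es: "set (edge_list Q) = polygon_edges Q"
    unfolding edge_list_def by blast
  then have "card (polygon_edges Q) \<le> length (edge_list Q)" by (metis card_length)
  then have "edge_list Q ! (k - 1) \<in> set (edge_list Q)" using assms(2) by (intro nth_mem) auto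
  then show ?thesis using es by (simp add: polygon_edge_def)
qed

section \<open>Coefficients of a sum\<close>

lemma expansion_at_0_coeff: "real_analytic_at_0 F \<Longrightarrow> expansion_at_0 F (coeff_at_0 F)"
  unfolding real_analytic_at_0_def using coeff_at_0_eq by blast

lemma expansion_at_0_add:
  assumes "expansion_at_0 F a" "expansion_at_0 G b"
  shows "expansion_at_0 (\<lambda>p. F p + G p) (\<lambda>p. a p + b p)"
proof -
  obtain r1 r2 where r: "r1 > 0" "r2 > 0"
    and F: "\<And>x y. \<bar>x\<bar> < r1 \<Longrightarrow> \<bar>y\<bar> < r1 \<Longrightarrow>
       ((\<lambda>(i, j). a (i, j) * x ^ i * y ^ j) has_sum F (x, y)) UNIV"
    and G: "\<And>x y. \<bar>x\<bar> < r2 \<Longrightarrow> \<bar>y\<bar> < r2 \<Longrightarrow>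
       ((\<lambda>(i, j). b (i, j) * x ^ i * y ^ j) has_sum G (x, y)) UNIV"
    using assms unfolding expansion_at_0_def by blast
  show ?thesis
    unfolding expansion_at_0_def
  proof (intro exI[of _ "min r1 r2"] conjI allI impI)
    fix x y assume "\<bar>x\<bar> < min r1 r2" "\<bar>y\<bar> < min r1 r2"
    then show "((\<lambda>(i, j). (a (i, j) + b (i, j)) * x ^ i * y ^ j) has_sum F (x, y) + G (x, y)) UNIV"
      using has_sum_add[OF F[of x y] G[of x y]] by (simp add: case_prod_unfold algebra_simps)
  qed (use r in auto)
qed

lemma nonzero_at_0_iff_supp:
  assumes "real_analytic_at_0 F"
  shows "nonzero_at_0 F \<longleftrightarrow> supp F \<noteq> {}"
proof -
  have "(\<forall>\<^sub>F p in nhds (0, 0). F p = 0) \<longleftrightarrow> expansion_at_0 F (\<lambda>_. 0)"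
  proof
    assume "\<forall>\<^sub>F p in nhds (0, 0). F p = 0"
    then obtain d where d: "d > 0" "\<And>p. dist p (0, 0) < d \<Longrightarrow> F p = 0"
      unfolding eventually_nhds_metric by blast
    have "F (x, y) = 0" if "\<bar>x\<bar> < d / 2" "\<bar>y\<bar> < d / 2" for x y
    proof -
      have "dist (x, y) (0, 0) \<le> \<bar>x\<bar> + \<bar>y\<bar>"
        using sqrt_sum_squares_le_sum_abs[of x y] by (simp add: dist_Pair_Pair)
      then show ?thesis using that d(2) by simp
    qed
    then show "expansion_at_0 F (\<lambda>_. 0)"
      unfolding expansion_at_0_def using d(1)
      by (intro exI[of _ "d / 2"]) (simp add: case_prod_unfold has_sum_0)
  next
    assume "expansion_at_0 F (\<lambda>_. 0)"
    then obtain r where r: "r > 0"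
      and F: "\<And>x y. \<bar>x\<bar> < r \<Longrightarrow> \<bar>y\<bar> < r \<Longrightarrow> ((\<lambda>_::nat \<times> nat. 0) has_sum F (x, y)) UNIV"
      unfolding expansion_at_0_def by (auto simp: case_prod_unfold)
    have "F p = 0" if "dist p (0, 0) < r" for p
    proof -
      have "\<bar>fst p\<bar> < r" "\<bar>snd p\<bar> < r"
        using that dist_fst_le[of p "(0, 0)"] dist_snd_le[of p "(0, 0)"] by (auto simp: dist_real_def)
      from has_sum_unique[OF F[OF this] has_sum_0] show ?thesis by simp
    qed
    then show "\<forall>\<^sub>F p in nhds (0, 0). F p = 0"
      unfolding eventually_nhds_metric using r by blast
  qed
  also have "\<dots> \<longleftrightarrow> coeff_at_0 F = (\<lambda>_. 0)"
    using coeff_at_0_eq expansion_at_0_coeff[OF assms] by metis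
  finally show ?thesis by (auto simp: nonzero_at_0_def supp_def fun_eq_iff)
qed

text \<open>Summing over all lattice points of the segment makes the index set independent of the
  function, so that polynomials of different functions can be compared termwise.\<close>

lemma segment_poly_lattice_points:
  assumes "finite {(i, j). (real i, real j) \<in> \<Gamma>}"
  shows "segment_poly F \<Gamma> =
    (\<Sum>(i, j) \<in> {(i, j). (real i, real j) \<in> \<Gamma>}. monom (coeff_at_0 F (i, j)) j)"
  unfolding segment_poly_def
  by (rule sum.mono_neutral_left[OF assms]) (auto simp: supp_def)

lemma segment_poly_add:
  assumes "finite {(i, j). (real i, real j) \<in> \<Gamma>}"
    and "\<And>p. coeff_at_0 S p = coeff_at_0 G p + coeff_at_0 H p"
  shows "segment_poly S \<Gamma> = segment_poly G \<Gamma> + segment_poly H \<Gamma>"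
  unfolding segment_poly_lattice_points[OF assms(1)] assms(2)
  by (simp add: case_prod_unfold sum.distrib flip: add_monom)

section \<open>The Newton polygon of a sum\<close>

text \<open>A vertex of only one of the two functions may be cancelled in the sum. It is then not a
  vertex of the common semi-hull, so only the vertices of the latter have to be found in the
  support of the sum.\<close>

lemma semi_hull_supp_sum:
  assumes coeff: "\<And>p. coeff_at_0 S p = coeff_at_0 G p + coeff_at_0 H p"
    and nc: "cancelled_vertices G H \<inter> cancelled_vertices H G = {}"
  shows "semi_hull (supp S) = semi_hull (newton_vertices G \<union> newton_vertices H)"
proof
  let ?V = "newton_vertices G \<union> newton_vertices H"
  have hulls: "semi_hull (supp F) \<subseteq> semi_hull ?V" if "F = G \<or> F = H" for F
    using that semi_hull_mono[of "newton_vertices F" ?V]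
    by (auto simp: newton_vertices_def semi_hull_polygon_vertices)
  show "semi_hull (supp S) \<subseteq> semi_hull ?V"
  proof (rule semi_hull_subset)
    fix i j assume "(i, j) \<in> supp S"
    then have "(i, j) \<in> supp G \<or> (i, j) \<in> supp H" by (auto simp: supp_def coeff)
    then show "(real i, real j) \<in> semi_hull ?V" using hulls semi_hull_generator by blast
  qed
  have vertex: "(i, j) \<in> newton_vertices F"
    if "(i, j) \<in> polygon_vertices ?V" "(i, j) \<in> supp F" "F = G \<or> F = H" for i j F
    using that hulls[of F] semi_hull_generator[of i j "supp F"]
    by (auto simp: newton_vertices_def polygon_vertices_iff_extreme extreme_point_of_def)
  have "polygon_vertices ?V \<subseteq> supp S"
  proof clarify
    fix i j assume v: "(i, j) \<in> polygon_vertices ?V"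
    then have "(i, j) \<in> supp G \<or> (i, j) \<in> supp H"
      using polygon_vertices_subset[of ?V] polygon_vertices_subset[of "supp G"]
        polygon_vertices_subset[of "supp H"]
      by (auto simp: newton_vertices_def)
    moreover have "coeff_at_0 G (i, j) + coeff_at_0 H (i, j) \<noteq> 0"
      if "(i, j) \<in> supp G" "(i, j) \<in> supp H"
      using that vertex[OF v that(1)] vertex[OF v that(2)] nc
      by (auto simp: cancelled_vertices_def add.commute)
    ultimately show "(i, j) \<in> supp S" by (auto simp: supp_def coeff)
  qed
  from semi_hull_mono[OF this]
  show "semi_hull ?V \<subseteq> semi_hull (supp S)" by (simp add: semi_hull_polygon_vertices)
qed

theorem proposition4p3:
  fixes G H :: "real \<times> real \<Rightarrow> real"
  defines "S \<equiv> (\<lambda>p. G p + H p)"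
    and "V \<equiv> newton_vertices G \<union> newton_vertices H"
  assumes "real_analytic_at_0 G" and "nonzero_at_0 G"
    and "real_analytic_at_0 H" and "nonzero_at_0 H"
    and "cancelled_vertices G H \<inter> cancelled_vertices H G = {}"
  shows "nonzero_at_0 S \<and>
    newton_polygon S = principal_boundary V \<and>
    (\<forall>k \<in> {1..num_newton_edges S}.
       segment_poly S (newton_edge S k) =
       segment_poly G (polygon_edge V k) + segment_poly H (polygon_edge V k))"
proof -
  have exp: "expansion_at_0 S (\<lambda>p. coeff_at_0 G p + coeff_at_0 H p)"
    unfolding S_def using assms(3,5) by (intro expansion_at_0_add expansion_at_0_coeff)
  then have an: "real_analytic_at_0 S" by (auto simp: real_analytic_at_0_def)
  have coeff: "coeff_at_0 S p = coeff_at_0 G p + coeff_at_0 H p" for p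
    by (simp add: coeff_at_0_eq[OF exp])
  have hull: "semi_hull (supp S) = semi_hull V"
    unfolding V_def using coeff assms(7) by (rule semi_hull_supp_sum)
  have "supp G \<noteq> {}" using nonzero_at_0_iff_supp assms(3,4) by blast
  then have "semi_hull (newton_vertices G) \<noteq> {}"
    by (simp add: newton_vertices_def semi_hull_polygon_vertices semi_hull_eq_empty_iff)
  then have V: "V \<noteq> {}" by (auto simp: V_def semi_hull_eq_empty_iff)
  then have "nonzero_at_0 S"
    using hull nonzero_at_0_iff_supp[OF an] semi_hull_eq_empty_iff by metis
  have pb: "principal_boundary (supp S) = principal_boundary V"
    by (simp add: principal_boundary_def hull)
  have edges: "polygon_edges (supp S) = polygon_edges V"
    by (simp add: polygon_edges_def hull pb)
  have edge: "newton_edge S k = polygon_edge V k" for k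
    by (simp add: newton_edge_def polygon_edge_def edge_list_def edges)
  have "segment_poly S (newton_edge S k) =
      segment_poly G (polygon_edge V k) + segment_poly H (polygon_edge V k)"
    if "k \<in> {1..num_newton_edges S}" for k
  proof -
    have "polygon_edge V k \<in> polygon_edges V"
      using that by (intro polygon_edge_in_polygon_edges V) (simp add: num_newton_edges_def edges)
    then have "finite {(i, j). (real i, real j) \<in> polygon_edge V k}"
      by (intro finite_lattice_points_principal_boundary[OF V]) (simp add: polygon_edges_def)
    then show ?thesis unfolding edge using coeff by (rule segment_poly_add)
  qed
  with \<open>nonzero_at_0 S\<close> pb show ?thesis by (simp add: newton_polygon_def)
qed

end
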